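(* Let $f_1,\dots,f_M:\mathbb{R}^n\to\mathbb{R}^n$ define the switched system $x_{k+1}=f_{\sigma(k)}(x_k)$, $k\in\mathbb{N}$, let $c:\mathbb{R}^n\to\mathbb{R}_{\ge0}$ be a cost function, and let $J$ be the value function of the system with cost $c$. Let $V:\mathbb{R}^n\to\mathbb{R}_{\ge0}$ satisfy $$V(x)\ge c(x)+\max_{i\in\{1,\dots,M\}}V(f_i(x)),\qquad\forall x\in\mathbb{R}^n.$$ Then $V(x)\ge J(x)$ for all $x\in\mathbb{R}^n$.
   Context: $\mathbb{N}$ includes $0$ and $M\ge1$. A switching signal is any function $\sigma:\mathbb{N}\to\{1,\dots,M\}$. For $x\in\mathbb{R}^n$, $\xi(\cdot,x,\sigma)$ denotes the solution with $\xi(0,x,\sigma)=x$ and $\xi(k+1,x,\sigma)=f_{\sigma(k)}(\xi(k,x,\sigma))$. The cost-to-go is $J_\sigma(x)=\sum_{k=0}^\infty c(\xi(k,x,\sigma))\in[0,+\infty]$ ($+\infty$ if the series diverges), and the value function is $J(x)=\sup_{\sigma:\mathbb{N}\to\{1,\dots,M\}}J_\sigma(x)$. *)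

theory Defs
  imports "HOL-Analysis.Analysis"
begin

definition switching_signals :: "nat \<Rightarrow> (nat \<Rightarrow> nat) set" where
  "switching_signals M = UNIV \<rightarrow> {1..M}"

primrec trajectory :: "(nat \<Rightarrow> 'a \<Rightarrow> 'a) \<Rightarrow> nat \<Rightarrow> 'a \<Rightarrow> (nat \<Rightarrow> nat) \<Rightarrow> 'a" where
  "trajectory f 0 x \<sigma> = x"
| "trajectory f (Suc k) x \<sigma> = f (\<sigma> k) (trajectory f k x \<sigma>)"

text \<open>Costs are summed in the extended reals: for nonnegative \<open>c\<close> the series always has a
  value in \<open>[0, \<infinity>]\<close>, which is \<open>\<infinity>\<close> exactly when the real series diverges.\<close>

definition cost_to_go ::
  "(nat \<Rightarrow> 'a \<Rightarrow> 'a) \<Rightarrow> ('a \<Rightarrow> real) \<Rightarrow> (nat \<Rightarrow> nat) \<Rightarrow> 'a \<Rightarrow> ereal" where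
  "cost_to_go f c \<sigma> x = (\<Sum>k. ereal (c (trajectory f k x \<sigma>)))"

definition value_function ::
  "nat \<Rightarrow> (nat \<Rightarrow> 'a \<Rightarrow> 'a) \<Rightarrow> ('a \<Rightarrow> real) \<Rightarrow> 'a \<Rightarrow> ereal" where
  "value_function M f c x = (SUP \<sigma>\<in>switching_signals M. cost_to_go f c \<sigma> x)"

end

theory Submission
  imports Defs
begin

text \<open>
  The inequality says that along every mode the storage function \<open>V\<close> drops by at least the
  running cost, because the maximum dominates the value at whichever successor the switching
  signal selects. Along a trajectory these drops telescope: the cost accumulated over \<open>N\<close> steps
  plus the remaining \<open>V\<close> is at most the initial \<open>V\<close> (\<open>dissipation_telescopes\<close>). Since \<open>V\<close> is
  nonnegative, the initial \<open>V\<close> bounds all partial sums, hence the series, by a bound that does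
  not depend on the signal, and so it also bounds the supremum.
\<close>

text \<open>Keeping the terminal value \<open>V\<close> on the left, rather than discarding it as nonnegative,
  is what makes the induction on \<open>N\<close> go through.\<close>

lemma dissipation_telescopes:
  fixes c V :: "'a \<Rightarrow> real"
  assumes "\<And>k x. c x + V (f (\<sigma> k) x) \<le> V x"
  shows "(\<Sum>k<N. c (trajectory f k x \<sigma>)) + V (trajectory f N x \<sigma>) \<le> V x"
proof (induction N)
  case 0
  show ?case by simp
next
  case (Suc N)
  with assms[of "trajectory f N x \<sigma>" N] show ?case by simp
qed

lemma cost_to_go_le_dissipation:
  fixes c V :: "'a \<Rightarrow> real"
  assumes c_nonneg: "\<And>x. 0 \<le> c x" and V_nonneg: "\<And>x. 0 \<le> V x"
    and dissip: "\<And>k x. c x + V (f (\<sigma> k) x) \<le> V x"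
  shows "cost_to_go f c \<sigma> x \<le> ereal (V x)"
  unfolding cost_to_go_def
proof (rule suminf_bound)
  show "0 \<le> ereal (c (trajectory f k x \<sigma>))" for k
    using c_nonneg by simp
  have "(\<Sum>k<N. c (trajectory f k x \<sigma>)) \<le> V x" for N
    using dissipation_telescopes[of c V f \<sigma>, OF dissip, of x N] V_nonneg[of "trajectory f N x \<sigma>"]
    by linarith
  then show "\<forall>N. (\<Sum>k<N. ereal (c (trajectory f k x \<sigma>))) \<le> ereal (V x)"
    by simp
qed

theorem proposition2:
  fixes M :: nat
    and f :: "nat \<Rightarrow> real ^ 'n \<Rightarrow> real ^ 'n"
    and c V :: "real ^ 'n \<Rightarrow> real"
  assumes "M \<ge> 1"
    and "\<And>x. c x \<ge> 0"
    and "\<And>x. V x \<ge> 0"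
    and "\<And>x. V x \<ge> c x + Max ((\<lambda>i. V (f i x)) ` {1..M})"
  shows "\<forall>x. ereal (V x) \<ge> value_function M f c x"
proof
  fix x
  show "value_function M f c x \<le> ereal (V x)"
    unfolding value_function_def
  proof (rule SUP_least)
    fix \<sigma> assume "\<sigma> \<in> switching_signals M"
    then have mode: "\<sigma> k \<in> {1..M}" for k
      unfolding switching_signals_def by (rule funcset_mem) simp
    have "c y + V (f (\<sigma> k) y) \<le> V y" for k y
    proof -
      have "V (f (\<sigma> k) y) \<le> Max ((\<lambda>i. V (f i y)) ` {1..M})"
        using mode by (intro Max_ge) auto
      with assms(4)[of y] show ?thesis by linarith
    qed
    then show "cost_to_go f c \<sigma> x \<le> ereal (V x)"
      using assms(2,3) by (intro cost_to_go_le_dissipation)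
  qed
qed

end
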